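(* Let $R$ be a commutative ring, let $\Lambda$ be any index set, and let $L \subseteq M$ be $R$-modules. Suppose $\{L_\lambda\}_{\lambda \in \Lambda}$ and $\{M_\lambda\}_{\lambda \in \Lambda}$ are families of submodules of $M$ such that $M = \sum_{\lambda\in\Lambda} M_\lambda$, $L = \sum_{\lambda\in \Lambda} L_\lambda$, and $L_\lambda \subseteq L \cap M_\lambda$ for each $\lambda\in \Lambda$. Then $$L^{\mathrm{li}}_{M} = \bigcup_{\sigma} \left(\sum_{\lambda\in\sigma} L_\lambda\right)^{\mathrm{li}}_{\sum_{\lambda\in\sigma} M_\lambda},$$ where $\sigma$ ranges over all finite subsets of $\Lambda$.
   Context: All rings are commutative with identity. Integral closure in a free module: let $F$ be a free $R$-module (not necessarily finitely generated) and $K \subseteq F$ a submodule. Let $S=\mathrm{Sym}_R(F)$ be the symmetric algebra with its natural grading ($S_1=F$), and let $T\subseteq S$ be the $R$-subalgebra generated by $K \subseteq F = S_1$. Then $K^-_F$ denotes the degree $1$ part of the integral closure of $T$ in $S$, i.e. the set of elements of $F$ that are integral over $T$. Liftable integral closure: let $L\subseteq M$ be $R$-modules, $\pi: F \to M$ a surjection from a free $R$-module $F$, and $K := \pi^{-1}(L)$. The liftable integral closure of $L$ in $M$ is $L^{\mathrm{li}}_M := \pi(K^-_F)$. It is a submodule of $M$ which does not depend on the choice of $\pi$. *)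

theory Defs
  imports "HOL-Library.Poly_Mapping" "HOL-Computational_Algebra.Polynomial"
begin

section \<open>Free modules and their symmetric algebras\<close>

text \<open>
  The free \<open>'r\<close>-module with basis \<open>B\<close> (of arbitrary cardinality) consists of the finitely
  supported functions from \<open>B\<close> to \<open>'r\<close>; the basis element of \<open>x \<in> B\<close> is \<open>Poly_Mapping.single x 1\<close>.
\<close>

definition free_module :: "'x set \<Rightarrow> ('x \<Rightarrow>\<^sub>0 'r::comm_ring_1) set" where
  "free_module B = {f. Poly_Mapping.keys f \<subseteq> B}"

text \<open>The linear map on a free module that sends the basis element of \<open>x\<close> to \<open>g x\<close>.\<close>

definition linear_extension ::
    "('r::comm_ring_1 \<Rightarrow> 'm::ab_group_add \<Rightarrow> 'm) \<Rightarrow> ('x \<Rightarrow> 'm) \<Rightarrow> ('x \<Rightarrow>\<^sub>0 'r) \<Rightarrow> 'm" where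
  "linear_extension scale g f = (\<Sum>x\<in>Poly_Mapping.keys f. scale (Poly_Mapping.lookup f x) (g x))"

text \<open>
  The symmetric algebra of the free module with basis \<open>B\<close> is the polynomial ring over \<open>'r\<close> in
  variables indexed by \<open>B\<close>: a polynomial is a finitely supported function from monomials
  \<open>'x \<Rightarrow>\<^sub>0 nat\<close> to coefficients. The map \<open>sym_incl\<close> identifies the free module with the part of
  degree one. The universal property of the symmetric algebra is shown in
  \<open>sym_algebra_universal\<close> below.
\<close>

definition sym_algebra :: "'x set \<Rightarrow> (('x \<Rightarrow>\<^sub>0 nat) \<Rightarrow>\<^sub>0 'r::comm_ring_1) set" where
  "sym_algebra B = {p. \<forall>m\<in>Poly_Mapping.keys p. Poly_Mapping.keys m \<subseteq> B}"

definition sym_const :: "'r::comm_ring_1 \<Rightarrow> (('x \<Rightarrow>\<^sub>0 nat) \<Rightarrow>\<^sub>0 'r)" where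
  "sym_const c = Poly_Mapping.single 0 c"

definition sym_incl :: "('x \<Rightarrow>\<^sub>0 'r::comm_ring_1) \<Rightarrow> (('x \<Rightarrow>\<^sub>0 nat) \<Rightarrow>\<^sub>0 'r)" where
  "sym_incl f = (\<Sum>x\<in>Poly_Mapping.keys f. Poly_Mapping.single (Poly_Mapping.single x 1) (Poly_Mapping.lookup f x))"

definition is_subalgebra :: "(('x \<Rightarrow>\<^sub>0 nat) \<Rightarrow>\<^sub>0 'r::comm_ring_1) set \<Rightarrow> bool" where
  "is_subalgebra A \<longleftrightarrow> range sym_const \<subseteq> A \<and> (\<forall>p\<in>A. \<forall>q\<in>A. p + q \<in> A \<and> p * q \<in> A)"

definition generated_subalgebra ::
    "(('x \<Rightarrow>\<^sub>0 nat) \<Rightarrow>\<^sub>0 'r::comm_ring_1) set \<Rightarrow> (('x \<Rightarrow>\<^sub>0 nat) \<Rightarrow>\<^sub>0 'r) set" where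
  "generated_subalgebra G = \<Inter>{A. is_subalgebra A \<and> G \<subseteq> A}"


section \<open>Integral closure in a free module and liftable integral closure\<close>

definition integral_over :: "'a::comm_ring_1 set \<Rightarrow> 'a \<Rightarrow> bool" where
  "integral_over T s \<longleftrightarrow> (\<exists>p. lead_coeff p = 1 \<and> (\<forall>i. coeff p i \<in> T) \<and> poly p s = 0)"

definition integral_closure :: "'a::comm_ring_1 set \<Rightarrow> 'a set \<Rightarrow> 'a set" where
  "integral_closure T S = {s\<in>S. integral_over T s}"

definition free_integral_closure ::
    "'x set \<Rightarrow> ('x \<Rightarrow>\<^sub>0 'r::comm_ring_1) set \<Rightarrow> ('x \<Rightarrow>\<^sub>0 'r) set" where
  "free_integral_closure B K =
    {f \<in> free_module B.
       sym_incl f \<in> integral_closure (generated_subalgebra (sym_incl ` K)) (sym_algebra B)}"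

text \<open>
  The closure of \<open>L\<close> in \<open>M\<close> computed with \<open>linear_extension scale g\<close> as the surjection from
  the free module with basis \<open>B\<close> onto \<open>M\<close>; here \<open>M\<close> is the image of that map.
\<close>

definition li_closure_via ::
    "('r::comm_ring_1 \<Rightarrow> 'm::ab_group_add \<Rightarrow> 'm) \<Rightarrow> 'x set \<Rightarrow> ('x \<Rightarrow> 'm) \<Rightarrow> 'm set \<Rightarrow> 'm set" where
  "li_closure_via scale B g L =
    linear_extension scale g `
      free_integral_closure B {f \<in> free_module B. linear_extension scale g f \<in> L}"

text \<open>
  The liftable integral closure of \<open>L\<close> in \<open>M\<close>, by means of the canonical surjection onto \<open>M\<close>
  from the free module whose basis is the underlying set of \<open>M\<close>. Any other surjection from a
  free module gives the same result: \<open>li_closure_via_eq\<close> below.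
\<close>

definition li_closure ::
    "('r::comm_ring_1 \<Rightarrow> 'm::ab_group_add \<Rightarrow> 'm) \<Rightarrow> 'm set \<Rightarrow> 'm set \<Rightarrow> 'm set" where
  "li_closure scale L M = li_closure_via scale M (\<lambda>x. x) L"

definition submodule_sum :: "('i \<Rightarrow> 'm::ab_group_add set) \<Rightarrow> 'i set \<Rightarrow> 'm set" where
  "submodule_sum N I =
    {\<Sum>i\<in>J. x i | J x. finite J \<and> J \<subseteq> I \<and> (\<forall>i\<in>J. x i \<in> N i)}"


section \<open>Universal property of the symmetric algebra\<close>

lemma sum_keys_superset:
  assumes "finite A" "Poly_Mapping.keys f \<subseteq> A" "\<And>x. F x 0 = 0"
  shows "(\<Sum>x\<in>Poly_Mapping.keys f. F x (Poly_Mapping.lookup f x)) = (\<Sum>x\<in>A. F x (Poly_Mapping.lookup f x))"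
  using assms by (intro sum.mono_neutral_left) (auto simp: in_keys_iff)

lemma poly_mapping_single_induct [case_names zero single_add]:
  fixes f :: "'x \<Rightarrow>\<^sub>0 'a::monoid_add"
  assumes "P 0" and "\<And>a b f. P f \<Longrightarrow> a \<notin> Poly_Mapping.keys f \<Longrightarrow> b \<noteq> 0 \<Longrightarrow> Poly_Mapping.keys (Poly_Mapping.single a b + f) = insert a (Poly_Mapping.keys f) \<Longrightarrow> P (Poly_Mapping.single a b + f)"
  shows "P f"
proof (induction f rule: update_induct)
  case const
  then show ?case using assms(1) .
next
  case (update f a b)
  have "Poly_Mapping.update a b f = Poly_Mapping.single a b + f"
    using update(1) by (intro poly_mapping_eqI) (auto simp: lookup_update lookup_add lookup_single when_def in_keys_iff)
  moreover have "Poly_Mapping.keys (Poly_Mapping.update a b f) = insert a (Poly_Mapping.keys f)"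
    using update(2) by (auto simp: keys_update)
  ultimately show ?case using assms(2)[OF update(3) update(1,2)] by metis
qed

definition eval_sym :: "('r::comm_ring_1 \<Rightarrow> 'c::comm_ring_1) \<Rightarrow> ('x \<Rightarrow> 'c) \<Rightarrow> (('x \<Rightarrow>\<^sub>0 nat) \<Rightarrow>\<^sub>0 'r) \<Rightarrow> 'c" where
  "eval_sym h v p = (\<Sum>m\<in>Poly_Mapping.keys p. h (Poly_Mapping.lookup p m) * (\<Prod>x\<in>Poly_Mapping.keys m. v x ^ Poly_Mapping.lookup m x))"

locale comm_ring_hom_1 =
  fixes h :: "'r::comm_ring_1 \<Rightarrow> 'c::comm_ring_1"
  assumes hom_one [simp]: "h 1 = 1"
    and hom_add: "h (a + b) = h a + h b"
    and hom_mult: "h (a * b) = h a * h b"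
begin

lemma hom_zero [simp]: "h 0 = 0"
  using hom_add[of 0 0] by simp

lemma hom_sum: "h (sum f A) = (\<Sum>a\<in>A. h (f a))"
  by (induction A rule: infinite_finite_induct) (auto simp: hom_add)

lemma hom_power: "h (a ^ n) = h a ^ n"
  by (induction n) (auto simp: hom_mult)

lemma hom_prod: "h (prod f A) = (\<Prod>a\<in>A. h (f a))"
  by (induction A rule: infinite_finite_induct) (auto simp: hom_mult)

lemma eval_sym_zero [simp]: "eval_sym h v 0 = 0"
  by (simp add: eval_sym_def)

lemma eval_sym_add: "eval_sym h v (p + q) = eval_sym h v p + eval_sym h v q"
  unfolding eval_sym_def
  by (rule setsum_keys_plus_distrib) (auto simp: hom_add algebra_simps)

lemma eval_sym_sum: "eval_sym h v (sum f A) = (\<Sum>a\<in>A. eval_sym h v (f a))"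
  by (induction A rule: infinite_finite_induct) (auto simp: eval_sym_add)

lemma eval_sym_single: "eval_sym h v (Poly_Mapping.single m c) = h c * (\<Prod>x\<in>Poly_Mapping.keys m. v x ^ Poly_Mapping.lookup m x)"
  by (simp add: eval_sym_def)

lemma eval_monom_add:
  fixes v :: "'x \<Rightarrow> 'c"
  shows "(\<Prod>x\<in>Poly_Mapping.keys (m + n). v x ^ Poly_Mapping.lookup (m + n) x) =
   (\<Prod>x\<in>Poly_Mapping.keys m. v x ^ Poly_Mapping.lookup m x) * (\<Prod>x\<in>Poly_Mapping.keys n. v x ^ Poly_Mapping.lookup n x)"
proof -
  let ?A = "Poly_Mapping.keys m \<union> Poly_Mapping.keys n"
  have *: "(\<Prod>x\<in>Poly_Mapping.keys k. v x ^ Poly_Mapping.lookup k x) = (\<Prod>x\<in>?A. v x ^ Poly_Mapping.lookup k x)" if "Poly_Mapping.keys k \<subseteq> ?A" for k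
    using that by (intro prod.mono_neutral_left) (auto simp: in_keys_iff)
  show ?thesis
    by (subst (1 2 3) *) (auto simp: lookup_add power_add prod.distrib in_keys_iff)
qed

lemma eval_sym_mult: "eval_sym h v (p * q) = eval_sym h v p * eval_sym h v q"
proof (induction p rule: poly_mapping_single_induct)
  case (single_add a b f)
  have "eval_sym h v (Poly_Mapping.single a b * q) = eval_sym h v (Poly_Mapping.single a b) * eval_sym h v q"
  proof (induction q rule: poly_mapping_single_induct)
    case (single_add a b f)
    then show ?case
      by (simp add: distrib_left eval_sym_add mult_single eval_sym_single eval_monom_add hom_mult mult_ac)
  qed simp
  with single_add show ?case
    by (simp add: distrib_right eval_sym_add)
qed simp

lemma eval_sym_const: "eval_sym h v (sym_const c) = h c"
  by (simp add: sym_const_def eval_sym_single)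

lemma eval_sym_one: "eval_sym h v 1 = 1"
  using eval_sym_const[of v 1] by (simp add: sym_const_def)

lemma eval_sym_incl: "eval_sym h v (sym_incl f) = (\<Sum>x\<in>Poly_Mapping.keys f. h (Poly_Mapping.lookup f x) * v x)"
  by (simp add: sym_incl_def eval_sym_sum eval_sym_single)

lemma comm_ring_hom_1_eval_sym: "comm_ring_hom_1 (eval_sym h v)"
  by standard (auto simp: eval_sym_add eval_sym_mult eval_sym_one)

end

lemma sym_incl_zero [simp]: "sym_incl 0 = 0"
  by (simp add: sym_incl_def)

lemma sym_incl_add: "sym_incl (f + g) = sym_incl f + sym_incl g"
  unfolding sym_incl_def
  by (rule setsum_keys_plus_distrib) (auto simp: single_add)

lemma sym_incl_single: "sym_incl (Poly_Mapping.single x c) = Poly_Mapping.single (Poly_Mapping.single x 1) c"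
  by (simp add: sym_incl_def)

lemma lookup_scaled: "Poly_Mapping.lookup (Poly_Mapping.map ((*) (r::'r::comm_ring_1)) f) x = r * Poly_Mapping.lookup f x"
  by (simp add: map.rep_eq when_def)

lemma sym_incl_scaled: "sym_incl (Poly_Mapping.map ((*) r) f) = sym_const r * sym_incl f"
proof -
  have "Poly_Mapping.keys (Poly_Mapping.map ((*) r) f) \<subseteq> Poly_Mapping.keys f"
    by (auto simp: in_keys_iff lookup_scaled)
  then show ?thesis
    unfolding sym_incl_def
    by (subst sum_keys_superset[where A = "Poly_Mapping.keys f" and F = "\<lambda>x c. Poly_Mapping.single (Poly_Mapping.single x 1) c"])
       (auto simp: lookup_scaled sum_distrib_left sym_const_def mult_single)
qed

lemma sym_incl_in_sym_algebra:
  assumes "f \<in> free_module B"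
  shows "sym_incl f \<in> sym_algebra B"
  using keys_sum[of "\<lambda>x. Poly_Mapping.single (Poly_Mapping.single x 1) (Poly_Mapping.lookup f x)" "Poly_Mapping.keys f"] assms
  unfolding sym_incl_def sym_algebra_def free_module_def
  by (fastforce split: if_splits)

lemma sym_incl_inj: "inj sym_incl"
proof (rule injI)
  fix f g :: "'x \<Rightarrow>\<^sub>0 'r::comm_ring_1"
  have *: "Poly_Mapping.lookup (sym_incl k) (Poly_Mapping.single x 1) = Poly_Mapping.lookup k x" for k :: "'x \<Rightarrow>\<^sub>0 'r::comm_ring_1" and x
  proof -
    have "(Poly_Mapping.single y (1::nat) = Poly_Mapping.single x 1) = (y = x)" for x y :: 'x
      by (metis lookup_single_eq lookup_single_not_eq zero_neq_one)
    then show ?thesis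
      by (auto simp: sym_incl_def lookup_sum lookup_single when_def in_keys_iff)
  qed
  assume "sym_incl f = sym_incl g"
  then show "f = g" by (intro poly_mapping_eqI) (metis *)
qed

lemma linear_on_free_module_eq:
  fixes \<phi> :: "('x \<Rightarrow>\<^sub>0 'r::comm_ring_1) \<Rightarrow> 'c::comm_ring_1"
  assumes add: "\<And>f g. f \<in> free_module B \<Longrightarrow> g \<in> free_module B \<Longrightarrow> \<phi> (f + g) = \<phi> f + \<phi> g"
    and scale: "\<And>r f. f \<in> free_module B \<Longrightarrow> \<phi> (Poly_Mapping.map ((*) r) f) = h r * \<phi> f"
    and "f \<in> free_module B"
  shows "\<phi> f = (\<Sum>x\<in>Poly_Mapping.keys f. h (Poly_Mapping.lookup f x) * \<phi> (Poly_Mapping.single x 1))"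
  using assms(3)
proof (induction f rule: poly_mapping_single_induct)
  case zero
  have "\<phi> 0 = 0" using add[of 0 0] by (simp add: free_module_def)
  then show ?case by simp
next
  case (single_add a b f)
  from single_add.prems single_add.hyps have f: "f \<in> free_module B" and a: "a \<in> B"
    by (auto simp: free_module_def)
  have b: "\<phi> (Poly_Mapping.single a b) = h b * \<phi> (Poly_Mapping.single a 1)"
    using scale[of "Poly_Mapping.single a 1" b] a by (simp add: free_module_def)
  have "\<phi> (Poly_Mapping.single a b + f) = \<phi> (Poly_Mapping.single a b) + \<phi> f"
    using f a by (intro add) (auto simp: free_module_def)
  also have "\<phi> f = (\<Sum>x\<in>Poly_Mapping.keys f. h (Poly_Mapping.lookup f x) * \<phi> (Poly_Mapping.single x 1))"
    using single_add.IH f by simp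
  also have "\<dots> = (\<Sum>x\<in>Poly_Mapping.keys f. h (Poly_Mapping.lookup (Poly_Mapping.single a b + f) x) * \<phi> (Poly_Mapping.single x 1))"
    using single_add.hyps by (intro sum.cong) (auto simp: lookup_add lookup_single when_def)
  finally show ?case
    using single_add.hyps by (simp add: b lookup_add in_keys_iff)
qed

theorem sym_algebra_universal:
  fixes h :: "'r::comm_ring_1 \<Rightarrow> 'c::comm_ring_1" and \<phi> :: "('x \<Rightarrow>\<^sub>0 'r) \<Rightarrow> 'c"
  assumes h: "comm_ring_hom_1 h"
    and add: "\<And>f g. f \<in> free_module B \<Longrightarrow> g \<in> free_module B \<Longrightarrow> \<phi> (f + g) = \<phi> f + \<phi> g"
    and scale: "\<And>r f. f \<in> free_module B \<Longrightarrow> \<phi> (Poly_Mapping.map ((*) r) f) = h r * \<phi> f"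
  shows "\<exists>\<Phi>. comm_ring_hom_1 \<Phi> \<and> (\<forall>c. \<Phi> (sym_const c) = h c) \<and> (\<forall>f\<in>free_module B. \<Phi> (sym_incl f) = \<phi> f)"
    and "\<lbrakk>comm_ring_hom_1 \<Phi>; \<And>c. \<Phi> (sym_const c) = h c; \<And>f. f \<in> free_module B \<Longrightarrow> \<Phi> (sym_incl f) = \<phi> f;
          comm_ring_hom_1 \<Psi>; \<And>c. \<Psi> (sym_const c) = h c; \<And>f. f \<in> free_module B \<Longrightarrow> \<Psi> (sym_incl f) = \<phi> f;
          p \<in> sym_algebra B\<rbrakk> \<Longrightarrow> \<Phi> p = \<Psi> p"
proof -
  interpret h: comm_ring_hom_1 h by fact
  show "\<exists>\<Phi>. comm_ring_hom_1 \<Phi> \<and> (\<forall>c. \<Phi> (sym_const c) = h c) \<and> (\<forall>f\<in>free_module B. \<Phi> (sym_incl f) = \<phi> f)"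
    using linear_on_free_module_eq[of B \<phi> h, OF add scale]
    by (intro exI[of _ "eval_sym h (\<lambda>x. \<phi> (Poly_Mapping.single x 1))"])
       (auto simp: h.comm_ring_hom_1_eval_sym h.eval_sym_const h.eval_sym_incl)
next
  have *: "\<Phi> p = eval_sym h (\<lambda>x. \<phi> (Poly_Mapping.single x 1)) p"
    if "comm_ring_hom_1 \<Phi>" and c: "\<And>c. \<Phi> (sym_const c) = h c"
      and incl: "\<And>f. f \<in> free_module B \<Longrightarrow> \<Phi> (sym_incl f) = \<phi> f"
      and "p \<in> sym_algebra B" for \<Phi> p
  proof -
    interpret \<Phi>: comm_ring_hom_1 \<Phi> by fact
    interpret h: comm_ring_hom_1 h by fact
    have single_power: "Poly_Mapping.single (Poly_Mapping.single x n) (1::'r) =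
        Poly_Mapping.single (Poly_Mapping.single x 1) 1 ^ n" for x :: 'x and n :: nat
    proof (induction n)
      case (Suc n)
      have "Poly_Mapping.single (Poly_Mapping.single x 1) (1::'r) * Poly_Mapping.single (Poly_Mapping.single x n) 1 =
          Poly_Mapping.single (Poly_Mapping.single x (Suc n)) 1"
        unfolding mult_single Poly_Mapping.single_add [symmetric] by simp
      then show ?case
        unfolding power_Suc Suc [symmetric] by (rule sym)
    qed simp
    have monom: "\<Phi> (Poly_Mapping.single m 1) = (\<Prod>x\<in>Poly_Mapping.keys m. \<phi> (Poly_Mapping.single x 1) ^ Poly_Mapping.lookup m x)" if "Poly_Mapping.keys m \<subseteq> B" for m
      using that
    proof (induction m rule: poly_mapping_single_induct)
      case (single_add a n m)
      have "\<Phi> (Poly_Mapping.single (Poly_Mapping.single a n) 1) = \<phi> (Poly_Mapping.single a 1) ^ n"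
        using incl[of "Poly_Mapping.single a 1"] single_add.prems single_add.hyps
        by (subst single_power) (simp add: \<Phi>.hom_power sym_incl_single free_module_def)
      moreover have "Poly_Mapping.single (Poly_Mapping.single a n + m) (1::'r) = Poly_Mapping.single (Poly_Mapping.single a n) 1 * Poly_Mapping.single m 1"
        by (simp add: mult_single)
      ultimately show ?case
        using single_add.IH single_add.prems single_add.hyps
        unfolding h.eval_monom_add by (simp add: \<Phi>.hom_mult)
    qed (simp add: \<Phi>.hom_one)
    from \<open>p \<in> sym_algebra B\<close> show ?thesis
    proof (induction p rule: poly_mapping_single_induct)
      case (single_add a b p)
      have "Poly_Mapping.single a b = sym_const b * Poly_Mapping.single a 1"
        by (simp add: sym_const_def mult_single)
      then have "\<Phi> (Poly_Mapping.single a b) = h b * (\<Prod>x\<in>Poly_Mapping.keys a. \<phi> (Poly_Mapping.single x 1) ^ Poly_Mapping.lookup a x)"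
        using single_add.prems single_add.hyps
        by (simp add: \<Phi>.hom_mult c monom sym_algebra_def)
      moreover have "p \<in> sym_algebra B"
        using single_add.prems single_add.hyps by (auto simp: sym_algebra_def)
      ultimately show ?case
        using single_add.IH by (simp add: \<Phi>.hom_add h.eval_sym_add h.eval_sym_single)
    qed simp
  qed
  show "\<Phi> p = \<Psi> p" if "comm_ring_hom_1 \<Phi>" "\<And>c. \<Phi> (sym_const c) = h c"
    "\<And>f. f \<in> free_module B \<Longrightarrow> \<Phi> (sym_incl f) = \<phi> f"
    "comm_ring_hom_1 \<Psi>" "\<And>c. \<Psi> (sym_const c) = h c"
    "\<And>f. f \<in> free_module B \<Longrightarrow> \<Psi> (sym_incl f) = \<phi> f" "p \<in> sym_algebra B"
    using *[of \<Phi> p] *[of \<Psi> p] that by simp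
qed


section \<open>Independence of the surjection\<close>

lemma is_subalgebra_generated: "is_subalgebra (generated_subalgebra G)"
  unfolding generated_subalgebra_def is_subalgebra_def by blast

lemma subset_generated_subalgebra: "G \<subseteq> generated_subalgebra G"
  unfolding generated_subalgebra_def by blast

lemma generated_subalgebra_least: "is_subalgebra A \<Longrightarrow> G \<subseteq> A \<Longrightarrow> generated_subalgebra G \<subseteq> A"
  unfolding generated_subalgebra_def by blast

lemma integral_over_image:
  assumes "comm_ring_hom_1 \<Phi>" "\<Phi> ` T \<subseteq> T'" "integral_over T s"
  shows "integral_over T' (\<Phi> s)"
proof -
  interpret comm_ring_hom_1 \<Phi> by fact
  obtain p where p: "lead_coeff p = 1" "\<And>i. coeff p i \<in> T" "poly p s = 0"
    using assms(3) unfolding integral_over_def by blast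
  have deg: "degree (map_poly \<Phi> p) = degree p"
    using p(1) by (intro map_poly_degree_eq) auto
  have "poly (map_poly \<Phi> p) (\<Phi> s) = \<Phi> (poly p s)"
    by (simp add: poly_altdef deg coeff_map_poly hom_sum hom_mult hom_power)
  with p show ?thesis
    unfolding integral_over_def using assms(2)
    by (intro exI[of _ "map_poly \<Phi> p"]) (auto simp: deg coeff_map_poly)
qed

lemma linear_extension_zero [simp]: "linear_extension scale g 0 = 0"
  by (simp add: linear_extension_def)

context module
begin

lemma linear_extension_add:
  "linear_extension scale g (p + q) = linear_extension scale g p + linear_extension scale g q"
  unfolding linear_extension_def
  by (rule setsum_keys_plus_distrib) (auto simp: scale_left_distrib)

lemma linear_extension_scaled:
  "linear_extension scale g (Poly_Mapping.map ((*) r) f) = r *s linear_extension scale g f"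
proof -
  have "Poly_Mapping.keys (Poly_Mapping.map ((*) r) f) \<subseteq> Poly_Mapping.keys f"
    by (auto simp: in_keys_iff lookup_scaled)
  then show ?thesis
    unfolding linear_extension_def
    by (subst sum_keys_superset[where A = "Poly_Mapping.keys f" and F = "\<lambda>x c. c *s g x"])
       (auto simp: lookup_scaled scale_sum_right)
qed

lemma linear_extension_sum:
  "linear_extension scale g (sum f A) = (\<Sum>a\<in>A. linear_extension scale g (f a))"
  by (induction A rule: infinite_finite_induct) (auto simp: linear_extension_add)

lemma linear_extension_single [simp]: "linear_extension scale g (Poly_Mapping.single x 1) = g x"
  by (simp add: linear_extension_def)

lemma free_module_sum:
  assumes "\<And>a. a \<in> A \<Longrightarrow> f a \<in> free_module B"
  shows "sum f A \<in> free_module B"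
  using keys_sum[of f A] assms unfolding free_module_def by fastforce

lemma li_closure_via_mono:
  fixes g :: "'x \<Rightarrow> 'b" and g' :: "'y \<Rightarrow> 'b"
  assumes sub: "linear_extension scale g ` free_module B \<subseteq> linear_extension scale g' ` free_module B'"
    and L: "L \<subseteq> L'"
  shows "li_closure_via scale B g L \<subseteq> li_closure_via scale B' g' L'"
proof
  fix z assume "z \<in> li_closure_via scale B g L"
  let ?K = "{f \<in> free_module B. linear_extension scale g f \<in> L}"
  let ?K' = "{f \<in> free_module B'. linear_extension scale g' f \<in> L'}"
  obtain f where f: "f \<in> free_module B"
    "integral_over (generated_subalgebra (sym_incl ` ?K)) (sym_incl f)"
    and z: "z = linear_extension scale g f"
    using \<open>z \<in> _\<close> unfolding li_closure_via_def free_integral_closure_def integral_closure_def by auto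
  have "\<exists>\<phi>. \<forall>x\<in>B. \<phi> x \<in> free_module B' \<and> linear_extension scale g' (\<phi> x) = g x"
  proof (intro bchoice ballI)
    fix x assume "x \<in> B"
    then have "g x \<in> linear_extension scale g ` free_module B"
      by (intro image_eqI[of _ _ "Poly_Mapping.single x 1"]) (auto simp: free_module_def)
    then show "\<exists>y. y \<in> free_module B' \<and> linear_extension scale g' y = g x"
      using sub by force
  qed
  then obtain \<phi> where \<phi>: "\<And>x. x \<in> B \<Longrightarrow> \<phi> x \<in> free_module B'"
    "\<And>x. x \<in> B \<Longrightarrow> linear_extension scale g' (\<phi> x) = g x" by metis
  define lift where "lift k = (\<Sum>x\<in>Poly_Mapping.keys k. Poly_Mapping.map ((*) (Poly_Mapping.lookup k x)) (\<phi> x))" for k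
  have const: "comm_ring_hom_1 (sym_const :: 'a \<Rightarrow> (('y \<Rightarrow>\<^sub>0 nat) \<Rightarrow>\<^sub>0 'a))"
    by standard (auto simp: sym_const_def single_add mult_single)
  define \<Phi> :: "(('x \<Rightarrow>\<^sub>0 nat) \<Rightarrow>\<^sub>0 'a) \<Rightarrow> (('y \<Rightarrow>\<^sub>0 nat) \<Rightarrow>\<^sub>0 'a)"
    where "\<Phi> = eval_sym sym_const (\<lambda>x. sym_incl (\<phi> x))"
  interpret \<Phi>: comm_ring_hom_1 \<Phi>
    unfolding \<Phi>_def by (rule comm_ring_hom_1.comm_ring_hom_1_eval_sym[OF const])
  have lift: "lift k \<in> free_module B'" "linear_extension scale g' (lift k) = linear_extension scale g k"
    if "k \<in> free_module B" for k
  proof -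
    have sub: "x \<in> B" if "x \<in> Poly_Mapping.keys k" for x
      using that \<open>k \<in> free_module B\<close> by (auto simp: free_module_def)
    show "lift k \<in> free_module B'"
      unfolding lift_def
      using \<phi>(1) sub by (intro free_module_sum) (force simp: free_module_def in_keys_iff lookup_scaled)
    show "linear_extension scale g' (lift k) = linear_extension scale g k"
      using \<phi>(2) sub
      by (simp add: lift_def linear_extension_sum linear_extension_scaled)
         (simp add: linear_extension_def)
  qed
  have sym_incl_sum: "sym_incl (sum u A) = (\<Sum>a\<in>A. sym_incl (u a))"
    for u :: "'x \<Rightarrow> 'y \<Rightarrow>\<^sub>0 'a" and A
    by (induction A rule: infinite_finite_induct) (auto simp: sym_incl_add)
  have \<Phi>_incl: "\<Phi> (sym_incl k) = sym_incl (lift k)" for k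
    by (simp add: \<Phi>_def comm_ring_hom_1.eval_sym_incl[OF const] lift_def sym_incl_sum sym_incl_scaled)
  have "generated_subalgebra (sym_incl ` ?K) \<subseteq> \<Phi> -` generated_subalgebra (sym_incl ` ?K')"
  proof (rule generated_subalgebra_least)
    have "\<Phi> (sym_const c) = sym_const c" for c
      by (simp add: \<Phi>_def comm_ring_hom_1.eval_sym_const[OF const])
    then show "is_subalgebra (\<Phi> -` generated_subalgebra (sym_incl ` ?K'))"
      using is_subalgebra_generated[of "sym_incl ` ?K'"]
      by (auto simp: is_subalgebra_def \<Phi>.hom_add \<Phi>.hom_mult)
    show "sym_incl ` ?K \<subseteq> \<Phi> -` generated_subalgebra (sym_incl ` ?K')"
      using subset_generated_subalgebra[of "sym_incl ` ?K'"] lift L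
      by (force simp: \<Phi>_incl)
  qed
  then have "integral_over (generated_subalgebra (sym_incl ` ?K')) (\<Phi> (sym_incl f))"
    by (intro integral_over_image[OF _ _ f(2)] \<Phi>.comm_ring_hom_1_axioms) auto
  then have "lift f \<in> free_integral_closure B' ?K'"
    using lift f(1)
    by (auto simp: free_integral_closure_def integral_closure_def \<Phi>_incl intro: sym_incl_in_sym_algebra)
  then show "z \<in> li_closure_via scale B' g' L'"
    unfolding li_closure_via_def z using lift(2)[OF f(1)] by force
qed

theorem li_closure_via_eq:
  fixes g :: "'x \<Rightarrow> 'b"
  assumes M: "subspace M" and surj: "linear_extension scale g ` free_module B = M"
  shows "li_closure_via scale B g L = li_closure scale L M"
proof -
  have "linear_extension scale (\<lambda>x. x) ` free_module M = M"
  proof (intro equalityI subsetI)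
    fix y assume "y \<in> linear_extension scale (\<lambda>x. x) ` free_module M"
    then obtain f where "Poly_Mapping.keys f \<subseteq> M" "y = (\<Sum>x\<in>Poly_Mapping.keys f. Poly_Mapping.lookup f x *s x)"
      by (auto simp: free_module_def linear_extension_def)
    then show "y \<in> M"
      using M by (auto intro!: subspace_sum subspace_scale)
  next
    fix y assume "y \<in> M"
    then show "y \<in> linear_extension scale (\<lambda>x. x) ` free_module M"
      by (intro image_eqI[of _ _ "Poly_Mapping.single y 1"]) (auto simp: free_module_def)
  qed
  with surj show ?thesis
    unfolding li_closure_def
    by (intro equalityI li_closure_via_mono) auto
qed

end

end

theory Submission
  imports Defs
begin

text \<open>
  Membership in a liftable integral closure has finite character. Let \<open>\<pi>\<close> be the canonical
  surjection onto \<open>M\<close> from the free module whose basis is the set \<open>M\<close>. If \<open>z \<in> M\<close> lies in the closure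
  of \<open>L\<close>, then \<open>z\<close> lifts to an element \<open>f\<close> of the free module on \<open>M\<close> satisfying one integral
  equation over the algebra generated by \<open>K = \<pi>\<^sup>-\<^sup>1(L)\<close>. The finitely many coefficients of
  that equation already lie in the algebra generated by a finite \<open>K\<^sub>0 \<subseteq> K\<close>
  (\<open>integral_over_generated_finitary\<close>). The elements of \<open>K\<^sub>0\<close> and \<open>f\<close> involve finitely many basis
  elements, which are elements of \<open>M\<close>, and \<open>\<pi>(K\<^sub>0)\<close> is a finite subset of \<open>L\<close>. Hence one finite
  \<open>\<sigma>\<close> suffices for all of them (\<open>finite_subset_submodule_sum\<close>): the basis elements lie in
  \<open>\<Sum>\<^sub>\<sigma> M\<^sub>\<lambda>\<close> and the images in \<open>\<Sum>\<^sub>\<sigma> L\<^sub>\<lambda>\<close>. Since the canonical presentation of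
  \<open>\<Sum>\<^sub>\<sigma> M\<^sub>\<lambda>\<close> has that set as its basis, \<open>K\<^sub>0\<close> and \<open>f\<close> live in the corresponding free submodule,
  and the same equation puts \<open>z = \<pi>(f)\<close> in the closure for \<open>\<sigma>\<close>.
  Linear relations in \<open>M\<close> may enter the equation as well; being elements of \<open>K\<^sub>0\<close> with image
  \<open>0\<close>, they pass to \<open>\<sigma>\<close> with the rest.
  The other inclusion is the monotonicity of the closure in both arguments.
\<close>

text \<open>
  Finitely many finite index sets have a finite union; this is the step from one witness per
  element to a single witness for a finite set.
\<close>

lemma finite_subset_common_index:
  assumes mono: "\<And>J J'. J \<subseteq> J' \<Longrightarrow> C J \<subseteq> C J'"
    and "finite X"
    and "\<And>x. x \<in> X \<Longrightarrow> \<exists>J. finite J \<and> J \<subseteq> I \<and> x \<in> C J"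
  shows "\<exists>J. finite J \<and> J \<subseteq> I \<and> X \<subseteq> C J"
  using assms(2,3)
proof (induction X rule: finite_induct)
  case empty
  then show ?case by blast
next
  case (insert x X)
  then obtain J J' where "finite J" "J \<subseteq> I" "X \<subseteq> C J" "finite J'" "J' \<subseteq> I" "x \<in> C J'"
    by (metis insert_iff)
  moreover have "C J \<subseteq> C (J \<union> J')" "C J' \<subseteq> C (J \<union> J')"
    by (simp_all add: mono)
  ultimately show ?case
    by (intro exI[of _ "J \<union> J'"]) auto
qed

lemma generated_subalgebra_mono:
  "G \<subseteq> G' \<Longrightarrow> generated_subalgebra G \<subseteq> generated_subalgebra G'"
  unfolding generated_subalgebra_def by blast

text \<open>
  The union of the subalgebras generated by finite subsets of \<open>G\<close> is directed, hence itself a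
  subalgebra, and it contains \<open>G\<close>.
\<close>

lemma generated_subalgebra_finitary:
  assumes "p \<in> generated_subalgebra G"
  shows "\<exists>G\<^sub>0. finite G\<^sub>0 \<and> G\<^sub>0 \<subseteq> G \<and> p \<in> generated_subalgebra G\<^sub>0"
proof -
  define U where "U = {p. \<exists>G\<^sub>0. finite G\<^sub>0 \<and> G\<^sub>0 \<subseteq> G \<and> p \<in> generated_subalgebra G\<^sub>0}"
  have U_I: "p \<in> U" if "finite G\<^sub>0" "G\<^sub>0 \<subseteq> G" "p \<in> generated_subalgebra G\<^sub>0" for p G\<^sub>0
    unfolding U_def using that by (intro CollectI exI conjI)
  have closed: "p + q \<in> U \<and> p * q \<in> U" if pq: "p \<in> U" "q \<in> U" for p q
  proof -
    have "\<exists>G\<^sub>0. finite G\<^sub>0 \<and> G\<^sub>0 \<subseteq> G \<and> {p, q} \<subseteq> generated_subalgebra G\<^sub>0"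
    proof (rule finite_subset_common_index[OF generated_subalgebra_mono])
      show "\<exists>G\<^sub>0. finite G\<^sub>0 \<and> G\<^sub>0 \<subseteq> G \<and> x \<in> generated_subalgebra G\<^sub>0" if "x \<in> {p, q}" for x
        using that pq unfolding U_def by (elim insertE) simp_all
    qed simp_all
    then obtain G\<^sub>0 where G\<^sub>0: "finite G\<^sub>0" "G\<^sub>0 \<subseteq> G"
      and "p \<in> generated_subalgebra G\<^sub>0" "q \<in> generated_subalgebra G\<^sub>0"
      unfolding insert_subset by (elim exE conjE)
    then have "p + q \<in> generated_subalgebra G\<^sub>0" "p * q \<in> generated_subalgebra G\<^sub>0"
      using is_subalgebra_generated[of G\<^sub>0] by (simp_all add: is_subalgebra_def)
    then show ?thesis
      by (intro conjI U_I[OF G\<^sub>0])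
  qed
  have "sym_const c \<in> U" for c
  proof (rule U_I)
    show "sym_const c \<in> generated_subalgebra {}"
      by (rule range_subsetD[OF conjunct1[OF is_subalgebra_generated[unfolded is_subalgebra_def]]])
  qed simp_all
  with closed have "is_subalgebra U"
    by (simp add: is_subalgebra_def image_subset_iff)
  moreover have "G \<subseteq> U"
  proof
    fix g assume "g \<in> G"
    then show "g \<in> U"
      using subset_generated_subalgebra[of "{g}"] by (intro U_I[of "{g}"]) simp_all
  qed
  ultimately have "generated_subalgebra G \<subseteq> U"
    by (rule generated_subalgebra_least)
  with assms have "p \<in> U"
    by (rule subsetD[rotated])
  then show ?thesis
    unfolding U_def by (rule CollectD)
qed

text \<open>An integral equation has finitely many coefficients.\<close>

lemma integral_over_generated_finitary:
  assumes "integral_over (generated_subalgebra G) s"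
  shows "\<exists>G\<^sub>0. finite G\<^sub>0 \<and> G\<^sub>0 \<subseteq> G \<and> integral_over (generated_subalgebra G\<^sub>0) s"
proof -
  obtain p where p: "lead_coeff p = 1" "\<And>i. coeff p i \<in> generated_subalgebra G" "poly p s = 0"
    using assms unfolding integral_over_def by blast
  have "range (coeff p) \<subseteq> insert 0 (coeff p ` {..degree p})"
  proof (intro image_subsetI)
    fix i show "coeff p i \<in> insert 0 (coeff p ` {..degree p})"
      by (cases "i \<le> degree p") (simp_all add: coeff_eq_0)
  qed
  then have fin: "finite (range (coeff p))"
    by (rule finite_subset) simp
  have "\<exists>G\<^sub>0. finite G\<^sub>0 \<and> G\<^sub>0 \<subseteq> G \<and> range (coeff p) \<subseteq> generated_subalgebra G\<^sub>0"
  proof (rule finite_subset_common_index[OF generated_subalgebra_mono fin])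
    show "\<exists>G\<^sub>0. finite G\<^sub>0 \<and> G\<^sub>0 \<subseteq> G \<and> c \<in> generated_subalgebra G\<^sub>0" if "c \<in> range (coeff p)" for c
      using that p(2) by (intro generated_subalgebra_finitary) (elim rangeE, simp)
  qed
  then obtain G\<^sub>0 where G\<^sub>0: "finite G\<^sub>0" "G\<^sub>0 \<subseteq> G" and "range (coeff p) \<subseteq> generated_subalgebra G\<^sub>0"
    by (elim exE conjE)
  with p have "integral_over (generated_subalgebra G\<^sub>0) s"
    unfolding integral_over_def image_subset_iff by (intro exI[of _ p]) simp
  with G\<^sub>0 show ?thesis
    by (intro exI conjI)
qed

lemma integral_over_mono:
  "T \<subseteq> T' \<Longrightarrow> integral_over T s \<Longrightarrow> integral_over T' s"
  unfolding integral_over_def by blast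

lemma submodule_sum_mono: "I \<subseteq> I' \<Longrightarrow> submodule_sum N I \<subseteq> submodule_sum N I'"
proof
  fix y assume I: "I \<subseteq> I'" and "y \<in> submodule_sum N I"
  then obtain J x where "y = (\<Sum>i\<in>J. x i)" "finite J" "J \<subseteq> I" "\<forall>i\<in>J. x i \<in> N i"
    unfolding submodule_sum_def by (elim CollectE exE conjE)
  moreover from \<open>J \<subseteq> I\<close> I have "J \<subseteq> I'"
    by (rule order_trans)
  ultimately show "y \<in> submodule_sum N I'"
    unfolding submodule_sum_def by (intro CollectI exI conjI)
qed

lemma finite_subset_submodule_sum:
  assumes "finite X" "X \<subseteq> submodule_sum N I"
  shows "\<exists>J. finite J \<and> J \<subseteq> I \<and> X \<subseteq> submodule_sum N J"
  using assms(1)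
proof (rule finite_subset_common_index[rotated])
  fix x assume "x \<in> X"
  then have "x \<in> submodule_sum N I"
    using assms(2) by blast
  then obtain J y where "x = (\<Sum>i\<in>J. y i)" and J: "finite J" "J \<subseteq> I" and "\<forall>i\<in>J. y i \<in> N i"
    unfolding submodule_sum_def by (elim CollectE exE conjE)
  then have "x \<in> submodule_sum N J"
    unfolding submodule_sum_def by (intro CollectI exI[of _ J] exI[of _ y] conjI) simp_all
  with J show "\<exists>J. finite J \<and> J \<subseteq> I \<and> x \<in> submodule_sum N J"
    by (intro exI conjI)
qed (rule submodule_sum_mono)

lemma linear_extension_free_module_mono:
  "M' \<subseteq> M \<Longrightarrow>
    linear_extension scale g ` free_module M' \<subseteq> linear_extension scale g ` free_module M"
  unfolding free_module_def by (intro image_mono Collect_mono impI) (rule order_trans)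

text \<open>
  The finite data behind one element of the closure. It is stated without reference to sums of
  families: any \<open>M'\<close> containing the finitely many basis elements \<open>X\<close> and any \<open>L'\<close> containing
  the finitely many images \<open>Y\<close> will do.
\<close>

lemma li_closure_finitary:
  assumes "z \<in> li_closure scale L M"
  shows "\<exists>X Y. finite X \<and> X \<subseteq> M \<and> finite Y \<and> Y \<subseteq> L \<and>
    (\<forall>M' L'. X \<subseteq> M' \<longrightarrow> Y \<subseteq> L' \<longrightarrow> z \<in> li_closure scale L' M')"
proof -
  let ?\<pi> = "linear_extension scale (\<lambda>x. x)"
  define K where "K M L = {k \<in> free_module M. ?\<pi> k \<in> L}" for M L
  obtain f where f: "f \<in> free_module M" and z: "z = ?\<pi> f"
    and int: "integral_over (generated_subalgebra (sym_incl ` K M L)) (sym_incl f)"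
    using assms
    unfolding li_closure_def li_closure_via_def free_integral_closure_def integral_closure_def K_def
    by auto
  obtain G where G: "finite G" "G \<subseteq> sym_incl ` K M L"
    and int_G: "integral_over (generated_subalgebra G) (sym_incl f)"
    using integral_over_generated_finitary[OF int] by blast
  obtain K\<^sub>0 where K\<^sub>0: "finite K\<^sub>0" "K\<^sub>0 \<subseteq> K M L" and G_eq: "G = sym_incl ` K\<^sub>0"
    using finite_subset_image[OF G] by blast
  define X where "X = (\<Union>k\<in>insert f K\<^sub>0. Poly_Mapping.keys k)"
  have "finite X" "X \<subseteq> M"
    using K\<^sub>0 f by (auto simp: X_def K_def free_module_def)
  moreover have "finite (?\<pi> ` K\<^sub>0)" "?\<pi> ` K\<^sub>0 \<subseteq> L"
    using K\<^sub>0 by (auto simp: K_def)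
  moreover have "z \<in> li_closure scale L' M'" if X: "X \<subseteq> M'" and Y: "?\<pi> ` K\<^sub>0 \<subseteq> L'" for M' L'
  proof -
    have f': "f \<in> free_module M'"
      using X by (auto simp: X_def free_module_def)
    have "K\<^sub>0 \<subseteq> K M' L'"
      using X Y by (auto simp: X_def K_def free_module_def)
    then have "generated_subalgebra G \<subseteq> generated_subalgebra (sym_incl ` K M' L')"
      unfolding G_eq by (intro generated_subalgebra_mono image_mono)
    then have "integral_over (generated_subalgebra (sym_incl ` K M' L')) (sym_incl f)"
      using int_G by (rule integral_over_mono)
    then have "f \<in> free_integral_closure M' (K M' L')"
      using f' sym_incl_in_sym_algebra[OF f']
      by (simp add: free_integral_closure_def integral_closure_def)
    then show ?thesis
      unfolding li_closure_def li_closure_via_def z K_def by (rule imageI)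
  qed
  ultimately show ?thesis
    by blast
qed

theorem lemma2p3:
  fixes scale :: "'r::comm_ring_1 \<Rightarrow> 'm::ab_group_add \<Rightarrow> 'm"
    and L M :: "'m set" and Lf Mf :: "'i \<Rightarrow> 'm set" and \<Lambda> :: "'i set"
  assumes "module scale"
    and "module.subspace scale M" and "module.subspace scale L" and "L \<subseteq> M"
    and "\<And>i. i \<in> \<Lambda> \<Longrightarrow> module.subspace scale (Mf i) \<and> Mf i \<subseteq> M"
    and "\<And>i. i \<in> \<Lambda> \<Longrightarrow> module.subspace scale (Lf i) \<and> Lf i \<subseteq> M"
    and "M = submodule_sum Mf \<Lambda>"
    and "L = submodule_sum Lf \<Lambda>"
    and "\<And>i. i \<in> \<Lambda> \<Longrightarrow> Lf i \<subseteq> L \<inter> Mf i"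
  shows "li_closure scale L M =
    (\<Union>\<sigma>\<in>{\<sigma>. finite \<sigma> \<and> \<sigma> \<subseteq> \<Lambda>}. li_closure scale (submodule_sum Lf \<sigma>) (submodule_sum Mf \<sigma>))"
proof (intro equalityI subsetI)
  fix z assume z_in: "z \<in> li_closure scale L M"
  obtain X Y where XY: "finite X" "X \<subseteq> M" "finite Y" "Y \<subseteq> L"
    and z: "\<forall>M' L'. X \<subseteq> M' \<longrightarrow> Y \<subseteq> L' \<longrightarrow> z \<in> li_closure scale L' M'"
    using li_closure_finitary[OF z_in] by (elim exE conjE)
  obtain \<sigma> where \<sigma>: "finite \<sigma>" "\<sigma> \<subseteq> \<Lambda>" "X \<subseteq> submodule_sum Mf \<sigma>"
    using finite_subset_submodule_sum[OF XY(1) XY(2)[unfolded assms(7)]] by (elim exE conjE)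
  obtain \<tau> where \<tau>: "finite \<tau>" "\<tau> \<subseteq> \<Lambda>" "Y \<subseteq> submodule_sum Lf \<tau>"
    using finite_subset_submodule_sum[OF XY(3) XY(4)[unfolded assms(8)]] by (elim exE conjE)
  have "z \<in> li_closure scale (submodule_sum Lf (\<sigma> \<union> \<tau>)) (submodule_sum Mf (\<sigma> \<union> \<tau>))"
  proof (rule z[rule_format])
    show "X \<subseteq> submodule_sum Mf (\<sigma> \<union> \<tau>)"
      using \<sigma>(3) submodule_sum_mono[of \<sigma> "\<sigma> \<union> \<tau>" Mf] by blast
    show "Y \<subseteq> submodule_sum Lf (\<sigma> \<union> \<tau>)"
      using \<tau>(3) submodule_sum_mono[of \<tau> "\<sigma> \<union> \<tau>" Lf] by blast
  qed
  then show "z \<in> (\<Union>\<sigma>\<in>{\<sigma>. finite \<sigma> \<and> \<sigma> \<subseteq> \<Lambda>}.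
      li_closure scale (submodule_sum Lf \<sigma>) (submodule_sum Mf \<sigma>))"
    using \<sigma>(1,2) \<tau>(1,2) by blast
next
  interpret module scale by fact
  fix z assume "z \<in> (\<Union>\<sigma>\<in>{\<sigma>. finite \<sigma> \<and> \<sigma> \<subseteq> \<Lambda>}.
      li_closure scale (submodule_sum Lf \<sigma>) (submodule_sum Mf \<sigma>))"
  then obtain \<sigma> where "\<sigma> \<subseteq> \<Lambda>"
    and z: "z \<in> li_closure scale (submodule_sum Lf \<sigma>) (submodule_sum Mf \<sigma>)"
    by blast
  have "li_closure scale (submodule_sum Lf \<sigma>) (submodule_sum Mf \<sigma>) \<subseteq> li_closure scale L M"
    unfolding li_closure_def assms(7,8) using \<open>\<sigma> \<subseteq> \<Lambda>\<close>
    by (intro li_closure_via_mono linear_extension_free_module_mono submodule_sum_mono)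
  with z show "z \<in> li_closure scale L M"
    by blast
qed

end
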